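(* Let $n\in\mathbb{N}$ and let $\mathbf{k}$ be a commutative ring. Let $j\in[n]$ and $m\in\mathbb{N}$ be such that $2m\geq n-j+2$. Let $i_1,i_2,\ldots,i_m$ be $m$ elements of $[j]$ (not necessarily distinct). Then, in $\mathbf{k}[S_n]$, $$[t_{i_1},t_j]\,[t_{i_2},t_j]\cdots[t_{i_m},t_j]=0.$$
   Context: Here $\mathbb{N}=\{0,1,2,\ldots\}$, and $[m]:=\{1,2,\ldots,m\}$. $S_n$ is the symmetric group on $[n]$, with product $(\pi\sigma)(i)=\pi(\sigma(i))$, viewed as a subset of the group algebra $\mathbf{k}[S_n]$. For distinct $i_1,\ldots,i_k\in[n]$, $\operatorname{cyc}_{i_1,\ldots,i_k}\in S_n$ is the cycle sending $i_1\mapsto i_2\mapsto\cdots\mapsto i_k\mapsto i_1$ and fixing all other elements (so $\operatorname{cyc}_i=\operatorname{id}=1$). For each $\ell\in[n]$, the somewhere-to-below shuffle is $t_\ell:=\operatorname{cyc}_{\ell}+\operatorname{cyc}_{\ell,\ell+1}+\operatorname{cyc}_{\ell,\ell+1,\ell+2}+\cdots+\operatorname{cyc}_{\ell,\ell+1,\ldots,n}\in\mathbf{k}[S_n]$. For elements $a,b$ of a ring, $[a,b]:=ab-ba$ is the commutator. *)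

theory Defs
  imports "HOL-Algebra.Ring" "HOL-Algebra.Sym_Groups"
begin

text \<open>
  The group algebra K[G]: finitely supported functions on G with values in K, where the function a
  stands for the formal sum of the a(g) g. The coefficient of g in a product a b is the sum of
  a(h) b(h') over all factorizations g = h h'; restricting h to the support of a makes this a
  finite sum even for infinite G.
\<close>
definition group_algebra ::
    "('k, 'r) ring_scheme \<Rightarrow> ('g, 'm) monoid_scheme \<Rightarrow> ('g \<Rightarrow> 'k) ring" where
  "group_algebra K G =
     \<lparr> carrier = {a \<in> carrier G \<rightarrow>\<^sub>E carrier K. finite {g \<in> carrier G. a g \<noteq> \<zero>\<^bsub>K\<^esub>}},
       monoid.mult = (\<lambda>a b. \<lambda>g\<in>carrier G.
         \<Oplus>\<^bsub>K\<^esub>h\<in>{h \<in> carrier G. a h \<noteq> \<zero>\<^bsub>K\<^esub>}. a h \<otimes>\<^bsub>K\<^esub> b (inv\<^bsub>G\<^esub> h \<otimes>\<^bsub>G\<^esub> g)),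
       one = (\<lambda>g\<in>carrier G. if g = \<one>\<^bsub>G\<^esub> then \<one>\<^bsub>K\<^esub> else \<zero>\<^bsub>K\<^esub>),
       zero = (\<lambda>g\<in>carrier G. \<zero>\<^bsub>K\<^esub>),
       add = (\<lambda>a b. \<lambda>g\<in>carrier G. a g \<oplus>\<^bsub>K\<^esub> b g) \<rparr>"

definition ga_of ::
    "('k, 'r) ring_scheme \<Rightarrow> ('g, 'm) monoid_scheme \<Rightarrow> 'g \<Rightarrow> ('g \<Rightarrow> 'k)" where
  "ga_of K G x = (\<lambda>g\<in>carrier G. if g = x then \<one>\<^bsub>K\<^esub> else \<zero>\<^bsub>K\<^esub>)"

definition commutator :: "('a, 'r) ring_scheme \<Rightarrow> 'a \<Rightarrow> 'a \<Rightarrow> 'a" where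
  "commutator R a b = a \<otimes>\<^bsub>R\<^esub> b \<ominus>\<^bsub>R\<^esub> b \<otimes>\<^bsub>R\<^esub> a"

abbreviation sym_group_algebra :: "('k, 'r) ring_scheme \<Rightarrow> nat \<Rightarrow> ((nat \<Rightarrow> nat) \<Rightarrow> 'k) ring" where
  "sym_group_algebra K n \<equiv> group_algebra K (sym_group n)"

text \<open>
  \<^const>\<open>cycle_of_list\<close> sends each list entry to the next one and the last entry to the first;
  on a one-element list it is the identity.
\<close>
definition somewhere_to_below ::
    "('k, 'r) ring_scheme \<Rightarrow> nat \<Rightarrow> nat \<Rightarrow> ((nat \<Rightarrow> nat) \<Rightarrow> 'k)" where
  "somewhere_to_below K n l =
     (\<Oplus>\<^bsub>sym_group_algebra K n\<^esub>w\<in>{l..n}. ga_of K (sym_group n) (cycle_of_list [l..<Suc w]))"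

definition list_product :: "('a, 'm) monoid_scheme \<Rightarrow> 'a list \<Rightarrow> 'a" where
  "list_product M xs = foldr (\<otimes>\<^bsub>M\<^esub>) xs \<one>\<^bsub>M\<^esub>"

end

theory Submission
  imports Defs
begin

text \<open>
  Let \<open>s\<^sub>u\<close> be the transposition of \<open>u\<close> and \<open>u + 1\<close>, so that \<open>t\<^sub>l = 1 + s\<^sub>l t\<^sub>l\<^sub>+\<^sub>1\<close>. Let \<open>H\<^sub>k\<close>, for \<open>k = j + 2d\<close>, be the set of
  all \<open>a\<close> with \<open>s\<^sub>u a = - a\<close> for \<open>u = j, j + 2, ..., k - 2\<close>. The point is that \<open>[t\<^sub>i, t\<^sub>j] H\<^sub>k \<subseteq> H\<^sub>k\<^sub>+\<^sub>2\<close>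
  for \<open>i \<le> j\<close>. For \<open>a \<in> H\<^sub>k\<close> the summands of \<open>t\<^sub>j a\<close> cancel in pairs up to \<open>b = s\<^sub>j \<cdots> s\<^sub>k\<^sub>-\<^sub>1 t\<^sub>k a\<close>, and the braid
  relations give \<open>s\<^sub>u b = - b\<close> for \<open>u = j + 1, j + 3, ..., k - 1\<close>. With \<open>w = s\<^sub>i \<cdots> s\<^sub>j\<^sub>-\<^sub>1\<close>, the element
  \<open>t\<^sub>i - w t\<^sub>j\<close> commutes with \<open>t\<^sub>j\<close>, so \<open>[t\<^sub>i, t\<^sub>j] = [w, t\<^sub>j] t\<^sub>j\<close>. Both \<open>b\<close> and \<open>w b\<close> again allow the pairwise
  cancellation, whence \<open>[t\<^sub>i, t\<^sub>j] a = [w, Q] b\<close> with \<open>Q = s\<^sub>j \<cdots> s\<^sub>k t\<^sub>k\<^sub>+\<^sub>1\<close>, and \<open>s\<^sub>u\<close> negates this for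
  \<open>u = j + 2, ..., k\<close>. For \<open>u = j\<close> one has \<open>(1 + s\<^sub>j) [t\<^sub>i, t\<^sub>j] = 0\<close>, because
  \<open>s\<^sub>j t\<^sub>j\<^sub>+\<^sub>1 t\<^sub>j = t\<^sub>j\<^sub>+\<^sub>1 t\<^sub>j\<close>. A product of \<open>m\<close> commutators therefore lies in \<open>H\<^sub>j\<^sub>+\<^sub>2\<^sub>m\<close>,
  which vanishes for \<open>j + 2m - 2 \<ge> n\<close> once one sets \<open>s\<^sub>u = 0\<close> for \<open>u \<ge> n\<close>.
\<close>

section \<open>Rings with braid relations\<close>

text \<open>
  The convention \<open>s u = 0\<close> for \<open>u \<ge> n\<close> keeps all the relations except \<open>s u\<^sup>2 = 1\<close> valid without
  boundary conditions, and it makes \<open>s u a = - a\<close> mean \<open>a = 0\<close> there.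
\<close>

locale shuffle_ring = ring R for R (structure) +
  fixes n :: nat and s t :: "nat \<Rightarrow> 'a"
  assumes s_closed [simp, intro]: "s u \<in> carrier R"
    and t_closed [simp, intro]: "t l \<in> carrier R"
    and s_comm: "Suc u < v \<Longrightarrow> s u \<otimes> s v = s v \<otimes> s u"
    and s_braid: "s u \<otimes> s (Suc u) \<otimes> s u = s (Suc u) \<otimes> s u \<otimes> s (Suc u)"
    and s_square: "0 < u \<Longrightarrow> u < n \<Longrightarrow> s u \<otimes> s u = \<one>"
    and s_zero: "n \<le> u \<Longrightarrow> s u = \<zero>"
    and t_rec: "t l = \<one> \<oplus> s l \<otimes> t (Suc l)"
begin

section \<open>Products of consecutive generators\<close>

text \<open>For \<open>0 < l\<close> and \<open>l + d \<le> n\<close> this becomes the cycle on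
  \<open>l, ..., l + d\<close> in the symmetric group algebra. As \<open>d\<close> counts factors,
  the last one is \<open>s (l + d - 1)\<close>.\<close>

fun s_prod :: "nat \<Rightarrow> nat \<Rightarrow> 'a" where
  "s_prod l 0 = \<one>"
| "s_prod l (Suc d) = s l \<otimes> s_prod (Suc l) d"

lemma s_prod_closed [simp, intro]: "s_prod l d \<in> carrier R"
  by (induction d arbitrary: l) auto

lemma t_top: "n \<le> l \<Longrightarrow> t l = \<one>"
  by (subst t_rec) (simp add: s_zero)

lemma commute_mult:
  assumes "x \<in> carrier R" "y \<in> carrier R" "z \<in> carrier R"
    and "x \<otimes> y = y \<otimes> x" "x \<otimes> z = z \<otimes> x"
  shows "x \<otimes> (y \<otimes> z) = (y \<otimes> z) \<otimes> x"
  using assms by (metis m_assoc)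

text \<open>\<open>t l\<close> involves only \<open>s v\<close> with \<open>v \<ge> l\<close>. The
  induction descends from \<open>n\<close>, where \<open>t\<close> becomes
  \<open>\<one>\<close>.\<close>

lemma s_t_comm: "Suc u < l \<Longrightarrow> s u \<otimes> t l = t l \<otimes> s u"
proof (induction "n - l" arbitrary: l)
  case 0
  then show ?case by (simp add: t_top)
next
  case (Suc m)
  then have "s u \<otimes> t (Suc l) = t (Suc l) \<otimes> s u"
    by (metis Suc_diff_Suc diff_Suc_Suc diff_Suc_eq_diff_pred less_SucI nat.inject zero_less_Suc zero_less_diff)
  then have "s u \<otimes> (s l \<otimes> t (Suc l)) = (s l \<otimes> t (Suc l)) \<otimes> s u"
    by (intro commute_mult) (auto intro: s_comm Suc.prems)
  then show ?case
    by (subst (1 2) t_rec) (simp add: r_distr l_distr)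
qed

text \<open>The factors have indices \<open>l\<close> to \<open>l + d - 1\<close>, so either
  alternative keeps \<open>u\<close> at distance at least 2 from each of them.\<close>

lemma s_s_prod_comm:
  assumes "Suc u < l \<or> l + d < u"
  shows "s u \<otimes> s_prod l d = s_prod l d \<otimes> s u"
  using assms
proof (induction d arbitrary: l)
  case (Suc d)
  have "s u \<otimes> s l = s l \<otimes> s u"
    using Suc.prems s_comm[of u l] s_comm[of l u] by force
  moreover have "s u \<otimes> s_prod (Suc l) d = s_prod (Suc l) d \<otimes> s u"
    using Suc.prems by (intro Suc.IH) auto
  ultimately show ?case by (simp add: commute_mult)
qed simp

lemma s_prod_t_comm:
  assumes "l + d < k"
  shows "t k \<otimes> s_prod l d = s_prod l d \<otimes> t k"
  using assms
proof (induction d arbitrary: l)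
  case (Suc d)
  have "t k \<otimes> s l = s l \<otimes> t k"
    using Suc.prems s_t_comm[of l k] by simp
  moreover have "t k \<otimes> s_prod (Suc l) d = s_prod (Suc l) d \<otimes> t k"
    using Suc.prems by (intro Suc.IH) auto
  ultimately show ?case by (simp add: commute_mult)
qed simp

lemma s_prod_Suc_right: "s_prod l (Suc d) = s_prod l d \<otimes> s (l + d)"
proof (induction d arbitrary: l)
  case (Suc d)
  have "s_prod l (Suc (Suc d)) = s l \<otimes> (s_prod (Suc l) d \<otimes> s (Suc l + d))"
    by (subst s_prod.simps(2), subst Suc.IH) simp
  then show ?case by (simp add: m_assoc)
qed simp

text \<open>Conjugation by a cycle shifts generators. Peeling off leading factors, which commute
  with \<open>s (Suc (l + e))\<close>, reduces this to \<open>e = 0\<close>, a braid relation in the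
  first two factors.\<close>

lemma s_s_prod_shift:
  "Suc e < d \<Longrightarrow> s (Suc (l + e)) \<otimes> s_prod l d = s_prod l d \<otimes> s (l + e)"
proof (induction e arbitrary: l d)
  case 0
  define d' where "d' = d - 2"
  with 0 have d: "d = Suc (Suc d')" by simp
  let ?p = "s_prod (Suc (Suc l)) d'"
  have "s (Suc l) \<otimes> s_prod l d = (s (Suc l) \<otimes> s l \<otimes> s (Suc l)) \<otimes> ?p"
    by (simp add: d m_assoc)
  also have "\<dots> = s l \<otimes> s (Suc l) \<otimes> (s l \<otimes> ?p)"
    by (simp add: s_braid[symmetric] m_assoc)
  also have "s l \<otimes> ?p = ?p \<otimes> s l"
    by (rule s_s_prod_comm) simp
  finally show ?case by (simp add: d m_assoc)
next
  case (Suc e)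
  then obtain d' where d: "d = Suc d'" by (cases d) auto
  let ?u = "Suc (l + Suc e)" and ?p = "s_prod (Suc l) d'"
  have "s ?u \<otimes> s_prod l d = (s ?u \<otimes> s l) \<otimes> ?p"
    by (simp add: d m_assoc)
  also have "s ?u \<otimes> s l = s l \<otimes> s ?u"
    by (rule s_comm[symmetric]) simp
  also have "s l \<otimes> s ?u \<otimes> ?p = s l \<otimes> (s (Suc (Suc l + e)) \<otimes> ?p)"
    by (simp add: m_assoc)
  also have "s (Suc (Suc l + e)) \<otimes> ?p = ?p \<otimes> s (Suc l + e)"
    using Suc.prems d by (intro Suc.IH) simp
  finally show ?case by (simp add: d m_assoc)
qed

text \<open>Downward induction on \<open>j\<close>. For \<open>Suc j < n\<close>, the product
  expands to \<open>?t \<oplus> (?s \<otimes> ?t \<oplus> y)\<close>; left multiplication by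
  \<open>?s\<close> exchanges the first two summands and fixes \<open>y\<close>.\<close>

lemma s_t_t:
  assumes "0 < j" "j < n"
  shows "s j \<otimes> (t (Suc j) \<otimes> t j) = t (Suc j) \<otimes> t j"
  using assms
proof (induction "n - j" arbitrary: j)
  case (Suc m)
  show ?case
  proof (cases "Suc j < n")
    case False
    with Suc.prems have "t (Suc j) = \<one>" by (intro t_top) simp
    moreover from this have "t j = \<one> \<oplus> s j" by (subst t_rec) simp
    moreover have "s j \<otimes> s j = \<one>" using Suc.prems by (rule s_square)
    ultimately show ?thesis by (simp add: r_distr a_comm)
  next
    case True
    let ?s = "s j" and ?r = "s (Suc j)" and ?t = "t (Suc j)" and ?T = "t (Suc (Suc j))"
    have IH: "?r \<otimes> (?T \<otimes> ?t) = ?T \<otimes> ?t"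
      using Suc True by (intro Suc.hyps(1)) auto
    have comm: "?T \<otimes> ?s = ?s \<otimes> ?T" by (rule s_t_comm[symmetric]) simp
    have ss: "?s \<otimes> (?s \<otimes> x) = x" if "x \<in> carrier R" for x
      using that s_square[OF Suc.prems] by (simp add: m_assoc[symmetric])
    have braid: "?r \<otimes> (?s \<otimes> (?r \<otimes> x)) = ?s \<otimes> (?r \<otimes> (?s \<otimes> x))" if "x \<in> carrier R" for x
      using that s_braid[of j] by (simp add: m_assoc[symmetric])
    define y where "y = ?r \<otimes> (?s \<otimes> (?T \<otimes> ?t))"
    have y [simp]: "y \<in> carrier R" by (simp add: y_def)
    have sy: "?s \<otimes> y = y"
    proof -
      \<comment> \<open>The induction hypothesis inserts the second \<open>?r\<close> that the braid
        relation needs.\<close>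
      have "y = ?r \<otimes> (?s \<otimes> (?r \<otimes> (?T \<otimes> ?t)))" by (simp add: y_def IH)
      then have "y = ?s \<otimes> (?r \<otimes> (?s \<otimes> (?T \<otimes> ?t)))" by (simp add: braid)
      then show ?thesis by (simp add: y_def)
    qed
    have "?t \<otimes> (?s \<otimes> ?t) = (\<one> \<oplus> ?r \<otimes> ?T) \<otimes> (?s \<otimes> ?t)"
      by (subst t_rec[of "Suc j"]) (rule refl)
    also have "\<dots> = ?s \<otimes> ?t \<oplus> ?r \<otimes> ((?T \<otimes> ?s) \<otimes> ?t)"
      by (simp add: l_distr m_assoc)
    also have "\<dots> = ?s \<otimes> ?t \<oplus> y"
      by (simp add: comm y_def m_assoc)
    finally have "?t \<otimes> t j = ?t \<oplus> (?s \<otimes> ?t \<oplus> y)"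
      by (subst t_rec[of j]) (simp add: r_distr)
    then show ?thesis
      by (simp add: r_distr ss sy a_lcomm)
  qed
qed simp

text \<open>Unrolling \<open>t_rec\<close> \<open>d\<close> times gives \<open>v\<close> as the sum
  of the \<open>s_prod i e\<close> with \<open>e < d\<close>. These involve only \<open>s u\<close>
  with \<open>u + 2 \<le> i + d\<close>, hence the commutation with \<open>t k\<close>.\<close>

lemma t_split:
  "\<exists>v\<in>carrier R. t i = v \<oplus> s_prod i d \<otimes> t (i + d) \<and>
     (\<forall>k. i + d \<le> k \<longrightarrow> v \<otimes> t k = t k \<otimes> v)"
proof (induction d)
  case 0
  show ?case by (intro bexI[of _ \<zero>]) auto
next
  case (Suc d)
  then obtain v where v: "v \<in> carrier R" "t i = v \<oplus> s_prod i d \<otimes> t (i + d)"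
    "\<And>k. i + d \<le> k \<Longrightarrow> v \<otimes> t k = t k \<otimes> v" by blast
  show ?case
  proof (intro bexI[of _ "v \<oplus> s_prod i d"] conjI allI impI)
    have "s_prod i d \<otimes> t (i + d) = s_prod i d \<oplus> s_prod i (Suc d) \<otimes> t (i + Suc d)"
      by (subst t_rec) (simp add: r_distr m_assoc s_prod_Suc_right del: s_prod.simps)
    with v(1,2) show "t i = v \<oplus> s_prod i d \<oplus> s_prod i (Suc d) \<otimes> t (i + Suc d)"
      by (simp add: a_assoc del: s_prod.simps)
    fix k assume "i + Suc d \<le> k"
    then show "(v \<oplus> s_prod i d) \<otimes> t k = t k \<otimes> (v \<oplus> s_prod i d)"
      using v(1,3) s_prod_t_comm[of i d k] by (simp add: l_distr r_distr)
  qed (use v(1) in simp)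
qed

section \<open>Elements negated by every second generator\<close>

text \<open>This is membership in \<open>H\<^sub>k\<close> for \<open>k = j + 2 * d\<close>. At
  \<open>d = 0\<close> it is membership in the carrier, so \<open>\<one>\<close> can start an
  induction.\<close>

definition alternating :: "nat \<Rightarrow> nat \<Rightarrow> 'a \<Rightarrow> bool" where
  "alternating j d a \<longleftrightarrow> a \<in> carrier R \<and> (\<forall>e<d. s (j + 2 * e) \<otimes> a = \<ominus> a)"

lemma alternating_closed: "alternating j d a \<Longrightarrow> a \<in> carrier R"
  by (simp add: alternating_def)

text \<open>Two uses of \<open>t_rec\<close> at \<open>?k\<close> produce \<open>a\<close> and
  \<open>s ?k \<otimes> a\<close>, which cancel, and a remainder whose prefix is two factors
  longer.\<close>

lemma t_mult_alternating:
  "alternating j d a \<Longrightarrow> t j \<otimes> a = s_prod j (2 * d) \<otimes> (t (j + 2 * d) \<otimes> a)"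
proof (induction d)
  case 0
  then show ?case by (simp add: alternating_def)
next
  case (Suc d)
  let ?k = "j + 2 * d" and ?p = "s_prod j (2 * d)"
  have a [simp]: "a \<in> carrier R" and sa: "s ?k \<otimes> a = \<ominus> a"
    using Suc.prems by (auto simp: alternating_def)
  have "t ?k \<otimes> a = a \<oplus> s ?k \<otimes> (t (Suc ?k) \<otimes> a)"
    by (subst t_rec) (simp add: l_distr m_assoc)
  also have "t (Suc ?k) \<otimes> a = a \<oplus> s (Suc ?k) \<otimes> (t (Suc (Suc ?k)) \<otimes> a)"
    by (subst t_rec) (simp add: l_distr m_assoc)
  also have "a \<oplus> s ?k \<otimes> \<dots> = s ?k \<otimes> (s (Suc ?k) \<otimes> (t (Suc (Suc ?k)) \<otimes> a))"
    by (simp add: r_distr sa r_neg2 r_neg1 a_assoc[symmetric] r_neg)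
  finally have "?p \<otimes> (t ?k \<otimes> a) = s_prod j (2 * Suc d) \<otimes> (t (j + 2 * Suc d) \<otimes> a)"
    using s_prod_Suc_right[of j "2 * d"] s_prod_Suc_right[of j "Suc (2 * d)"]
    by (simp add: m_assoc del: s_prod.simps)
  moreover have "alternating j d a" using Suc.prems by (auto simp: alternating_def)
  ultimately show ?case using Suc.IH by simp
qed

text \<open>Moving the generator through \<open>s_prod l d\<close> lowers its index to
  \<open>l + e\<close>; it then commutes with \<open>t (l + d)\<close> and reaches \<open>a\<close>,
  which it negates.\<close>

lemma s_neg_shift:
  assumes [simp]: "a \<in> carrier R" and sa: "s (l + e) \<otimes> a = \<ominus> a" and e: "Suc e < d"
  shows "s (Suc (l + e)) \<otimes> (s_prod l d \<otimes> (t (l + d) \<otimes> a)) = \<ominus> (s_prod l d \<otimes> (t (l + d) \<otimes> a))"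
proof -
  let ?p = "s_prod l d" and ?t = "t (l + d)" and ?u = "l + e"
  have "s (Suc ?u) \<otimes> (?p \<otimes> (?t \<otimes> a)) = (s (Suc ?u) \<otimes> ?p) \<otimes> (?t \<otimes> a)"
    by (simp add: m_assoc)
  also have "s (Suc ?u) \<otimes> ?p = ?p \<otimes> s ?u"
    using e by (rule s_s_prod_shift)
  also have "?p \<otimes> s ?u \<otimes> (?t \<otimes> a) = ?p \<otimes> ((s ?u \<otimes> ?t) \<otimes> a)"
    by (simp add: m_assoc)
  also have "s ?u \<otimes> ?t = ?t \<otimes> s ?u"
    using e by (intro s_t_comm) simp
  also have "?p \<otimes> (?t \<otimes> s ?u \<otimes> a) = \<ominus> (?p \<otimes> (?t \<otimes> a))"
    by (simp add: m_assoc sa r_minus)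
  finally show ?thesis .
qed

text \<open>The negated generators start at \<open>Suc j\<close>, so the leading summand
  \<open>x\<close> has no partner and survives; the cancellation takes place inside
  \<open>t (Suc j) \<otimes> x\<close>.\<close>

lemma t_mult_alternating_Suc:
  assumes "alternating (Suc j) d x"
  shows "t j \<otimes> x = x \<oplus> s_prod j (Suc (2 * d)) \<otimes> (t (j + Suc (2 * d)) \<otimes> x)"
proof -
  have x [simp]: "x \<in> carrier R" using assms by (rule alternating_closed)
  have "t j \<otimes> x = x \<oplus> s j \<otimes> (t (Suc j) \<otimes> x)"
    by (subst t_rec) (simp add: l_distr m_assoc)
  then show ?thesis
    using t_mult_alternating[OF assms] by (simp add: m_assoc)
qed

section \<open>Commutators of two shuffles\<close>

text \<open>By \<open>t_split\<close>, \<open>t i\<close> is \<open>w \<otimes> t j\<close> plus an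
  element commuting with \<open>t j\<close>, which drops out.\<close>

lemma commutator_t:
  assumes "i \<le> j"
  defines "w \<equiv> s_prod i (j - i)"
  shows "commutator R (t i) (t j) = w \<otimes> t j \<otimes> t j \<ominus> t j \<otimes> w \<otimes> t j"
proof -
  have w [simp]: "w \<in> carrier R" by (simp add: w_def)
  obtain v where v: "v \<in> carrier R" "t i = v \<oplus> w \<otimes> t j" "v \<otimes> t j = t j \<otimes> v"
    using t_split[of i "j - i"] assms by auto
  have "commutator R (t i) (t j) = (t j \<otimes> v \<oplus> w \<otimes> t j \<otimes> t j) \<ominus> (t j \<otimes> v \<oplus> t j \<otimes> w \<otimes> t j)"
    using v(1,3) by (simp add: commutator_def v(2) l_distr r_distr m_assoc)
  moreover have "(z \<oplus> x) \<ominus> (z \<oplus> y) = x \<ominus> y" if "x \<in> carrier R" "y \<in> carrier R" "z \<in> carrier R" for x y z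
    using that by algebra
  ultimately show ?thesis using v(1) by simp
qed

lemma commutator_closed: "commutator R (t i) (t j) \<in> carrier R"
  by (simp add: commutator_def)

text \<open>For \<open>j < n\<close>, both products in \<open>commutator_t\<close> contain
  \<open>w \<otimes> t j\<close>; removing it leaves \<open>x \<ominus> s j \<otimes> x\<close>,
  which \<open>s j\<close> negates because it squares to \<open>\<one>\<close>.\<close>

lemma s_commutator_t:
  assumes "0 < j" "i \<le> j"
  shows "s j \<otimes> commutator R (t i) (t j) = \<ominus> commutator R (t i) (t j)"
proof (cases "j < n")
  case False
  then have "commutator R (t i) (t j) = \<zero>"
    by (simp add: commutator_def t_top minus_eq r_neg)
  then show ?thesis by simp
next
  case True
  define w where "w = s_prod i (j - i)"
  let ?s = "s j" and ?t = "t j" and ?T = "t (Suc j)"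
  define x where "x = w \<otimes> (?T \<otimes> ?t)"
  define y where "y = ?s \<otimes> x"
  have w [simp]: "w \<in> carrier R" by (simp add: w_def)
  have [simp]: "x \<in> carrier R" "y \<in> carrier R" by (simp_all add: x_def y_def)
  have Tw: "?T \<otimes> w = w \<otimes> ?T"
    unfolding w_def using assms by (intro s_prod_t_comm) simp
  have "w \<otimes> ?t \<otimes> ?t = w \<otimes> ?t \<oplus> w \<otimes> (?s \<otimes> (?T \<otimes> ?t))"
    by (subst t_rec) (simp add: l_distr r_distr m_assoc)
  \<comment> \<open>Here \<open>?s\<close> stands next to \<open>?T \<otimes> ?t\<close> and is
    absorbed by \<open>s_t_t\<close>; in the second product it stays in front of
    \<open>w\<close>.\<close>
  also have "\<dots> = w \<otimes> ?t \<oplus> x"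
    using s_t_t[OF assms(1) True] by (simp add: x_def)
  finally have 1: "w \<otimes> ?t \<otimes> ?t = w \<otimes> ?t \<oplus> x" .
  have "?t \<otimes> w \<otimes> ?t = w \<otimes> ?t \<oplus> ?s \<otimes> ((?T \<otimes> w) \<otimes> ?t)"
    by (subst t_rec) (simp add: l_distr r_distr m_assoc)
  also have "\<dots> = w \<otimes> ?t \<oplus> y"
    unfolding Tw by (simp add: x_def y_def m_assoc)
  finally have 2: "?t \<otimes> w \<otimes> ?t = w \<otimes> ?t \<oplus> y" .
  have "commutator R (t i) (t j) = (w \<otimes> ?t \<oplus> x) \<ominus> (w \<otimes> ?t \<oplus> y)"
    using commutator_t[OF assms(2)] 1 2 by (simp add: w_def)
  moreover have "(z \<oplus> x) \<ominus> (z \<oplus> y) = x \<ominus> y" if "z \<in> carrier R" for z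
    using that \<open>x \<in> carrier R\<close> \<open>y \<in> carrier R\<close> by algebra
  ultimately have "commutator R (t i) (t j) = x \<ominus> y" by simp
  moreover have "?s \<otimes> y = x"
    using s_square[OF assms(1) True] by (simp add: y_def m_assoc[symmetric])
  ultimately show ?thesis
    by (simp add: minus_eq r_distr r_minus minus_add y_def[symmetric] a_comm)
qed

text \<open>Index \<open>j\<close> comes from \<open>s_commutator_t\<close>. Each old index moves up
  by two: by one in passing to \<open>t j \<otimes> a\<close>, and by one more through
  \<open>Q\<close>.\<close>

lemma alternating_commutator:
  assumes "0 < j" "i \<le> j" and alt: "alternating j d a"
  shows "alternating j (Suc d) (commutator R (t i) (t j) \<otimes> a)"
proof -
  define w where "w = s_prod i (j - i)"
  \<comment> \<open>\<open>Q x\<close> is what \<open>t j \<otimes> x\<close> contains besides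
    \<open>x\<close> when \<open>alternating (Suc j) d x\<close> holds.\<close>
  define Q where "Q x = s_prod j (Suc (2 * d)) \<otimes> (t (j + Suc (2 * d)) \<otimes> x)" for x
  define b where "b = t j \<otimes> a"
  have a [simp]: "a \<in> carrier R" using alt by (rule alternating_closed)
  have w [simp]: "w \<in> carrier R" by (simp add: w_def)
  have b [simp]: "b \<in> carrier R" by (simp add: b_def)
  have Q [simp]: "x \<in> carrier R \<Longrightarrow> Q x \<in> carrier R" for x by (simp add: Q_def)
  \<comment> \<open>\<open>w\<close> is a product of \<open>s v\<close> with \<open>v < j\<close>,
    so each \<open>s u\<close> with \<open>u > j\<close> passes it.\<close>
  have sw: "s u \<otimes> (w \<otimes> x) = w \<otimes> (s u \<otimes> x)" if "j < u" "x \<in> carrier R" for u x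
    using that s_s_prod_comm[of u i "j - i"] assms(2) by (simp add: w_def m_assoc[symmetric])
  have sb: "s (Suc (j + 2 * e)) \<otimes> b = \<ominus> b" if "e < d" for e
    unfolding b_def t_mult_alternating[OF alt]
    using that alt by (intro s_neg_shift) (auto simp: alternating_def)
  have swb: "s (Suc (j + 2 * e)) \<otimes> (w \<otimes> b) = \<ominus> (w \<otimes> b)" if "e < d" for e
    using sb[OF that] by (simp add: sw r_minus)
  have sQ: "s (Suc (j + Suc (2 * e))) \<otimes> Q x = \<ominus> Q x"
    if "x \<in> carrier R" "s (Suc (j + 2 * e)) \<otimes> x = \<ominus> x" "e < d" for x e
    unfolding Q_def using that by (intro s_neg_shift) auto
  have "alternating (Suc j) d b" "alternating (Suc j) d (w \<otimes> b)"
    using sb swb by (simp_all add: alternating_def)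
  then have "t j \<otimes> b = b \<oplus> Q b" "t j \<otimes> (w \<otimes> b) = w \<otimes> b \<oplus> Q (w \<otimes> b)"
    unfolding Q_def by (simp_all only: t_mult_alternating_Suc)
  moreover have "commutator R (t i) (t j) \<otimes> a = w \<otimes> (t j \<otimes> b) \<ominus> t j \<otimes> (w \<otimes> b)"
    using commutator_t[OF assms(2)] by (simp add: w_def b_def minus_eq l_distr l_minus m_assoc)
  ultimately have "commutator R (t i) (t j) \<otimes> a
      = (w \<otimes> b \<oplus> w \<otimes> Q b) \<ominus> (w \<otimes> b \<oplus> Q (w \<otimes> b))"
    by (simp add: r_distr)
  moreover have "(z \<oplus> x) \<ominus> (z \<oplus> y) = x \<ominus> y" if "x \<in> carrier R" "y \<in> carrier R" "z \<in> carrier R" for x y z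
    using that by algebra
  ultimately have C: "commutator R (t i) (t j) \<otimes> a = w \<otimes> Q b \<ominus> Q (w \<otimes> b)" by simp
  have "s (j + 2 * e) \<otimes> (commutator R (t i) (t j) \<otimes> a) = \<ominus> (commutator R (t i) (t j) \<otimes> a)"
    if "e < Suc d" for e
  proof (cases e)
    case 0
    then show ?thesis
      using s_commutator_t[OF assms(1,2)] commutator_closed
      by (simp add: m_assoc[symmetric] l_minus)
  next
    case (Suc e')
    with that have e': "e' < d" by simp
    let ?u = "Suc (j + Suc (2 * e'))"
    have u: "j + 2 * e = ?u" using Suc by simp
    have "s ?u \<otimes> (w \<otimes> Q b) = \<ominus> (w \<otimes> Q b)"
      using sQ[OF b sb[OF e'] e'] by (simp add: sw r_minus del: add_Suc_right)
    moreover have "s ?u \<otimes> Q (w \<otimes> b) = \<ominus> Q (w \<otimes> b)"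
      using swb[OF e'] e' by (intro sQ) simp_all
    ultimately show ?thesis
      unfolding C u by (simp add: minus_eq r_distr r_minus minus_add del: add_Suc_right)
  qed
  then show ?thesis
    using commutator_closed by (simp add: alternating_def)
qed

text \<open>\<open>foldr\<close> builds the product by left multiplications starting from
  \<open>\<one>\<close>, and each factor raises \<open>d\<close> by one.\<close>

lemma alternating_commutator_product:
  assumes "0 < j" "\<forall>i\<in>set xs. i \<le> j"
  shows "alternating j (length xs) (list_product R (map (\<lambda>i. commutator R (t i) (t j)) xs))"
  using assms(2)
proof (induction xs)
  case Nil
  show ?case by (simp add: alternating_def list_product_def)
next
  case (Cons i xs)
  then have "alternating j (Suc (length xs)) (commutator R (t i) (t j) \<otimes>
      list_product R (map (\<lambda>i. commutator R (t i) (t j)) xs))"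
    using assms(1) by (intro alternating_commutator) auto
  then show ?case by (simp add: list_product_def)
qed

lemma commutator_product_eq_zero:
  assumes "0 < j" "j \<le> n" "\<forall>i\<in>set xs. i \<le> j" and "n + 2 \<le> j + 2 * length xs"
  shows "list_product R (map (\<lambda>i. commutator R (t i) (t j)) xs) = \<zero>" (is "?x = _")
proof -
  have alt: "alternating j (length xs) ?x"
    using assms(1,3) by (rule alternating_commutator_product)
  then have x: "?x \<in> carrier R" by (rule alternating_closed)
  \<comment> \<open>The last negated index is \<open>j + 2 * e\<close>. The bounds make the list
    nonempty and put this index at \<open>n\<close> or beyond, where \<open>s\<close> is
    \<open>\<zero>\<close>.\<close>
  define e where "e = length xs - 1"
  have "e < length xs" "n \<le> j + 2 * e"
    using assms(2,4) by (auto simp: e_def)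
  then have "\<zero> \<otimes> ?x = \<ominus> ?x"
    using alt s_zero[of "j + 2 * e"] by (auto simp: alternating_def)
  then show ?thesis
    using x by (metis l_null minus_minus minus_zero)
qed

end

section \<open>Group algebras of finite groups\<close>

lemma (in abelian_monoid) finsum_swap:
  assumes "finite A" "finite B" and f: "\<And>x y. x \<in> A \<Longrightarrow> y \<in> B \<Longrightarrow> f x y \<in> carrier G"
  shows "(\<Oplus>x\<in>A. \<Oplus>y\<in>B. f x y) = (\<Oplus>y\<in>B. \<Oplus>x\<in>A. f x y)"
  using assms(1) f
proof (induction A)
  case empty
  then show ?case by simp
next
  case (insert a A)
  have "(\<Oplus>x\<in>insert a A. \<Oplus>y\<in>B. f x y) = (\<Oplus>y\<in>B. f a y) \<oplus> (\<Oplus>x\<in>A. \<Oplus>y\<in>B. f x y)"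
    using insert.hyps insert.prems by (intro finsum_insert) auto
  also have "\<dots> = (\<Oplus>y\<in>B. f a y) \<oplus> (\<Oplus>y\<in>B. \<Oplus>x\<in>A. f x y)"
    using insert by simp
  also have "\<dots> = (\<Oplus>y\<in>B. f a y \<oplus> (\<Oplus>x\<in>A. f x y))"
    using insert.prems by (intro finsum_addf[symmetric]) auto
  also have "\<dots> = (\<Oplus>y\<in>B. \<Oplus>x\<in>insert a A. f x y)"
    using insert.hyps insert.prems by (intro finsum_cong' refl finsum_insert[symmetric]) auto
  finally show ?case .
qed

text \<open>For finite \<open>G\<close> the carrier is the full function space, and convolution sums
  can run over the whole group.\<close>

locale finite_group_algebra = K: ring K + G: group G
  for K :: "('k, 'r) ring_scheme" and G :: "('g, 'm) monoid_scheme" +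
  assumes finite_carrier: "finite (carrier G)"
begin

abbreviation KG :: "('g \<Rightarrow> 'k) ring" where "KG \<equiv> group_algebra K G"

lemma carrier_KG: "carrier KG = carrier G \<rightarrow>\<^sub>E carrier K"
  using finite_carrier by (auto simp: group_algebra_def)

lemma KG_apply_closed: "a \<in> carrier KG \<Longrightarrow> g \<in> carrier G \<Longrightarrow> a g \<in> carrier K"
  by (auto simp: carrier_KG)

lemma KG_eqI:
  assumes "a \<in> carrier KG" "b \<in> carrier KG" "\<And>g. g \<in> carrier G \<Longrightarrow> a g = b g"
  shows "a = b"
  using assms unfolding carrier_KG by (intro PiE_ext)

lemma zero_KG_apply: "g \<in> carrier G \<Longrightarrow> \<zero>\<^bsub>KG\<^esub> g = \<zero>\<^bsub>K\<^esub>"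
  and one_KG: "\<one>\<^bsub>KG\<^esub> = ga_of K G \<one>\<^bsub>G\<^esub>"
  and add_KG_apply: "g \<in> carrier G \<Longrightarrow> (a \<oplus>\<^bsub>KG\<^esub> b) g = a g \<oplus>\<^bsub>K\<^esub> b g"
  and ga_of_apply: "g \<in> carrier G \<Longrightarrow> ga_of K G x g = (if g = x then \<one>\<^bsub>K\<^esub> else \<zero>\<^bsub>K\<^esub>)"
  by (simp_all add: group_algebra_def ga_of_def)

text \<open>Summands outside the support of \<open>a\<close> vanish. A range independent of
  \<open>a\<close> lets sums be added and interchanged.\<close>

lemma mult_KG_apply:
  assumes a: "a \<in> carrier KG" and b: "b \<in> carrier KG" and g: "g \<in> carrier G"
  shows "(a \<otimes>\<^bsub>KG\<^esub> b) g = (\<Oplus>\<^bsub>K\<^esub>h\<in>carrier G. a h \<otimes>\<^bsub>K\<^esub> b (inv\<^bsub>G\<^esub> h \<otimes>\<^bsub>G\<^esub> g))"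
proof -
  have "(\<Oplus>\<^bsub>K\<^esub>h\<in>{h \<in> carrier G. a h \<noteq> \<zero>\<^bsub>K\<^esub>}. a h \<otimes>\<^bsub>K\<^esub> b (inv\<^bsub>G\<^esub> h \<otimes>\<^bsub>G\<^esub> g))
      = (\<Oplus>\<^bsub>K\<^esub>h\<in>carrier G. a h \<otimes>\<^bsub>K\<^esub> b (inv\<^bsub>G\<^esub> h \<otimes>\<^bsub>G\<^esub> g))"
    using a b g finite_carrier
    by (intro K.add.finprod_mono_neutral_cong_left) (auto simp: KG_apply_closed)
  then show ?thesis using g by (simp add: group_algebra_def)
qed

lemma ga_of_closed: "ga_of K G x \<in> carrier KG"
  by (auto simp: carrier_KG ga_of_def)

lemma zero_KG_closed: "\<zero>\<^bsub>KG\<^esub> \<in> carrier KG"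
  unfolding carrier_KG by (auto simp: group_algebra_def)

lemma add_KG_closed: "a \<in> carrier KG \<Longrightarrow> b \<in> carrier KG \<Longrightarrow> a \<oplus>\<^bsub>KG\<^esub> b \<in> carrier KG"
  unfolding carrier_KG by (auto simp: group_algebra_def)

lemma mult_KG_closed:
  assumes "a \<in> carrier KG" "b \<in> carrier KG"
  shows "a \<otimes>\<^bsub>KG\<^esub> b \<in> carrier KG"
proof -
  have "(a \<otimes>\<^bsub>KG\<^esub> b) g \<in> carrier K" if "g \<in> carrier G" for g
    using that assms by (simp add: mult_KG_apply KG_apply_closed Pi_def)
  then show ?thesis
    unfolding carrier_KG by (auto simp: group_algebra_def)
qed

lemma ga_of_mult_apply:
  assumes "x \<in> carrier G" "b \<in> carrier KG" "g \<in> carrier G"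
  shows "(ga_of K G x \<otimes>\<^bsub>KG\<^esub> b) g = b (inv\<^bsub>G\<^esub> x \<otimes>\<^bsub>G\<^esub> g)"
proof -
  let ?f = "\<lambda>h. b (inv\<^bsub>G\<^esub> h \<otimes>\<^bsub>G\<^esub> g)"
  have f: "?f \<in> carrier G \<rightarrow> carrier K"
    using assms by (auto intro: KG_apply_closed)
  have "(ga_of K G x \<otimes>\<^bsub>KG\<^esub> b) g = (\<Oplus>\<^bsub>K\<^esub>h\<in>carrier G. if x = h then ?f h else \<zero>\<^bsub>K\<^esub>)"
    unfolding mult_KG_apply[OF ga_of_closed assms(2,3)]
    using assms by (intro K.finsum_cong') (auto simp: ga_of_apply KG_apply_closed)
  also have "\<dots> = ?f x"
    using assms(1) finite_carrier f by (rule K.finsum_singleton)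
  finally show ?thesis .
qed

lemma ga_of_mult:
  assumes "x \<in> carrier G" "y \<in> carrier G"
  shows "ga_of K G x \<otimes>\<^bsub>KG\<^esub> ga_of K G y = ga_of K G (x \<otimes>\<^bsub>G\<^esub> y)"
proof (rule KG_eqI)
  fix g assume g: "g \<in> carrier G"
  have "inv\<^bsub>G\<^esub> x \<otimes>\<^bsub>G\<^esub> g = y \<longleftrightarrow> g = x \<otimes>\<^bsub>G\<^esub> y"
    using assms g by (metis G.inv_solve_left)
  then show "(ga_of K G x \<otimes>\<^bsub>KG\<^esub> ga_of K G y) g = ga_of K G (x \<otimes>\<^bsub>G\<^esub> y) g"
    using assms g by (simp add: ga_of_mult_apply ga_of_closed ga_of_apply)
qed (simp_all add: mult_KG_closed ga_of_closed)

text \<open>The two sums are interchanged, and the inner one is reindexed by left translation by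
  \<open>k\<close>, which permutes the group.\<close>

lemma mult_KG_assoc:
  assumes a: "a \<in> carrier KG" and b: "b \<in> carrier KG" and c: "c \<in> carrier KG"
  shows "(a \<otimes>\<^bsub>KG\<^esub> b) \<otimes>\<^bsub>KG\<^esub> c = a \<otimes>\<^bsub>KG\<^esub> (b \<otimes>\<^bsub>KG\<^esub> c)"
proof (rule KG_eqI)
  fix g assume g: "g \<in> carrier G"
  note [simp] = KG_apply_closed[OF a] KG_apply_closed[OF b] KG_apply_closed[OF c] g finite_carrier
  let ?f = "\<lambda>h k. a k \<otimes>\<^bsub>K\<^esub> (b (inv\<^bsub>G\<^esub> k \<otimes>\<^bsub>G\<^esub> h) \<otimes>\<^bsub>K\<^esub> c (inv\<^bsub>G\<^esub> h \<otimes>\<^bsub>G\<^esub> g))"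
  have "((a \<otimes>\<^bsub>KG\<^esub> b) \<otimes>\<^bsub>KG\<^esub> c) g = (\<Oplus>\<^bsub>K\<^esub>h\<in>carrier G. \<Oplus>\<^bsub>K\<^esub>k\<in>carrier G. ?f h k)"
    unfolding mult_KG_apply[OF mult_KG_closed[OF a b] c g]
    by (intro K.finsum_cong' refl)
      (auto simp: mult_KG_apply a b K.finsum_ldistr K.m_assoc intro!: K.finsum_cong')
  also have "\<dots> = (\<Oplus>\<^bsub>K\<^esub>k\<in>carrier G. \<Oplus>\<^bsub>K\<^esub>h\<in>carrier G. ?f h k)"
    by (rule K.finsum_swap) simp_all
  also have "\<dots> = (\<Oplus>\<^bsub>K\<^esub>k\<in>carrier G. a k \<otimes>\<^bsub>K\<^esub> (b \<otimes>\<^bsub>KG\<^esub> c) (inv\<^bsub>G\<^esub> k \<otimes>\<^bsub>G\<^esub> g))"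
  proof (intro K.finsum_cong' refl)
    fix k assume k: "k \<in> carrier G"
    have inj: "inj_on ((\<otimes>\<^bsub>G\<^esub>) k) (carrier G)" and surj: "(\<otimes>\<^bsub>G\<^esub>) k ` carrier G = carrier G"
      using k by (simp_all add: G.inj_on_cmult G.surj_const_mult)
    have "(\<Oplus>\<^bsub>K\<^esub>h\<in>carrier G. ?f h k) = (\<Oplus>\<^bsub>K\<^esub>h\<in>(\<otimes>\<^bsub>G\<^esub>) k ` carrier G. ?f h k)"
      by (simp add: surj)
    also have "\<dots> = (\<Oplus>\<^bsub>K\<^esub>h\<in>carrier G. ?f (k \<otimes>\<^bsub>G\<^esub> h) k)"
      using k inj by (intro K.finsum_reindex) auto
    also have "\<dots> = (\<Oplus>\<^bsub>K\<^esub>h\<in>carrier G. a k \<otimes>\<^bsub>K\<^esub> (b h \<otimes>\<^bsub>K\<^esub> c (inv\<^bsub>G\<^esub> h \<otimes>\<^bsub>G\<^esub> (inv\<^bsub>G\<^esub> k \<otimes>\<^bsub>G\<^esub> g))))"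
      using k by (intro K.finsum_cong') (auto simp: G.inv_mult_group G.m_assoc[symmetric])
    also have "\<dots> = a k \<otimes>\<^bsub>K\<^esub> (b \<otimes>\<^bsub>KG\<^esub> c) (inv\<^bsub>G\<^esub> k \<otimes>\<^bsub>G\<^esub> g)"
      using k by (simp add: mult_KG_apply b c K.finsum_rdistr Pi_def)
    finally show "(\<Oplus>\<^bsub>K\<^esub>h\<in>carrier G. ?f h k) = a k \<otimes>\<^bsub>K\<^esub> (b \<otimes>\<^bsub>KG\<^esub> c) (inv\<^bsub>G\<^esub> k \<otimes>\<^bsub>G\<^esub> g)" .
  qed (use mult_KG_closed[OF b c] in \<open>auto simp: KG_apply_closed\<close>)
  also have "\<dots> = (a \<otimes>\<^bsub>KG\<^esub> (b \<otimes>\<^bsub>KG\<^esub> c)) g"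
    by (simp add: mult_KG_apply a mult_KG_closed[OF b c])
  finally show "((a \<otimes>\<^bsub>KG\<^esub> b) \<otimes>\<^bsub>KG\<^esub> c) g = (a \<otimes>\<^bsub>KG\<^esub> (b \<otimes>\<^bsub>KG\<^esub> c)) g" .
qed (use assms in \<open>simp_all add: mult_KG_closed\<close>)

lemma mult_KG_one:
  assumes a: "a \<in> carrier KG"
  shows "a \<otimes>\<^bsub>KG\<^esub> \<one>\<^bsub>KG\<^esub> = a"
proof (rule KG_eqI)
  fix g assume g: "g \<in> carrier G"
  have eq: "inv\<^bsub>G\<^esub> h \<otimes>\<^bsub>G\<^esub> g = \<one>\<^bsub>G\<^esub> \<longleftrightarrow> g = h" if "h \<in> carrier G" for h
    using that g by (metis G.inv_solve_left G.r_one G.one_closed)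
  have "(a \<otimes>\<^bsub>KG\<^esub> \<one>\<^bsub>KG\<^esub>) g = (\<Oplus>\<^bsub>K\<^esub>h\<in>carrier G. if g = h then a h else \<zero>\<^bsub>K\<^esub>)"
    unfolding one_KG mult_KG_apply[OF a ga_of_closed g]
    using g a by (intro K.finsum_cong') (auto simp: eq ga_of_apply KG_apply_closed)
  also have "\<dots> = a g"
    using g finite_carrier a by (intro K.finsum_singleton) (auto intro: KG_apply_closed)
  finally show "(a \<otimes>\<^bsub>KG\<^esub> \<one>\<^bsub>KG\<^esub>) g = a g" .
qed (simp_all add: a one_KG mult_KG_closed ga_of_closed)

lemma one_mult_KG:
  assumes a: "a \<in> carrier KG"
  shows "\<one>\<^bsub>KG\<^esub> \<otimes>\<^bsub>KG\<^esub> a = a"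
  using a by (intro KG_eqI) (simp_all add: one_KG mult_KG_closed ga_of_closed ga_of_mult_apply)

lemma ring_KG: "ring KG"
proof (rule ringI)
  show "abelian_group KG"
  proof (rule abelian_groupI)
    fix a assume a: "a \<in> carrier KG"
    let ?b = "\<lambda>g\<in>carrier G. \<ominus>\<^bsub>K\<^esub> a g"
    have b: "?b \<in> carrier KG" using a by (auto simp: carrier_KG)
    have "?b \<oplus>\<^bsub>KG\<^esub> a = \<zero>\<^bsub>KG\<^esub>"
      using a b by (intro KG_eqI)
        (auto simp: add_KG_closed zero_KG_closed add_KG_apply zero_KG_apply KG_apply_closed K.l_neg)
    with b show "\<exists>b\<in>carrier KG. b \<oplus>\<^bsub>KG\<^esub> a = \<zero>\<^bsub>KG\<^esub>" by blast
  qed (auto intro!: KG_eqI simp: add_KG_closed zero_KG_closed add_KG_apply zero_KG_apply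
      KG_apply_closed K.a_assoc K.a_comm K.a_lcomm)
  show "monoid KG"
    by (rule monoidI)
      (simp_all add: mult_KG_closed one_KG ga_of_closed mult_KG_assoc
        mult_KG_one[unfolded one_KG] one_mult_KG[unfolded one_KG])
  fix a b c assume abc: "a \<in> carrier KG" "b \<in> carrier KG" "c \<in> carrier KG"
  show "(a \<oplus>\<^bsub>KG\<^esub> b) \<otimes>\<^bsub>KG\<^esub> c = a \<otimes>\<^bsub>KG\<^esub> c \<oplus>\<^bsub>KG\<^esub> b \<otimes>\<^bsub>KG\<^esub> c"
  proof (rule KG_eqI)
    fix g assume g: "g \<in> carrier G"
    note [simp] = abc KG_apply_closed add_KG_closed mult_KG_closed mult_KG_apply add_KG_apply g
    have "((a \<oplus>\<^bsub>KG\<^esub> b) \<otimes>\<^bsub>KG\<^esub> c) g = (\<Oplus>\<^bsub>K\<^esub>h\<in>carrier G.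
        a h \<otimes>\<^bsub>K\<^esub> c (inv\<^bsub>G\<^esub> h \<otimes>\<^bsub>G\<^esub> g) \<oplus>\<^bsub>K\<^esub> b h \<otimes>\<^bsub>K\<^esub> c (inv\<^bsub>G\<^esub> h \<otimes>\<^bsub>G\<^esub> g))"
      unfolding mult_KG_apply[OF add_KG_closed[OF abc(1,2)] abc(3) g]
      by (intro K.finsum_cong') (auto simp: K.l_distr)
    also have "\<dots> = (a \<otimes>\<^bsub>KG\<^esub> c \<oplus>\<^bsub>KG\<^esub> b \<otimes>\<^bsub>KG\<^esub> c) g"
      by simp
    finally show "((a \<oplus>\<^bsub>KG\<^esub> b) \<otimes>\<^bsub>KG\<^esub> c) g = (a \<otimes>\<^bsub>KG\<^esub> c \<oplus>\<^bsub>KG\<^esub> b \<otimes>\<^bsub>KG\<^esub> c) g" .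
  qed (simp_all add: abc add_KG_closed mult_KG_closed)
  show "c \<otimes>\<^bsub>KG\<^esub> (a \<oplus>\<^bsub>KG\<^esub> b) = c \<otimes>\<^bsub>KG\<^esub> a \<oplus>\<^bsub>KG\<^esub> c \<otimes>\<^bsub>KG\<^esub> b"
  proof (rule KG_eqI)
    fix g assume g: "g \<in> carrier G"
    note [simp] = abc KG_apply_closed add_KG_closed mult_KG_closed mult_KG_apply add_KG_apply g
    have "(c \<otimes>\<^bsub>KG\<^esub> (a \<oplus>\<^bsub>KG\<^esub> b)) g = (\<Oplus>\<^bsub>K\<^esub>h\<in>carrier G.
        c h \<otimes>\<^bsub>K\<^esub> a (inv\<^bsub>G\<^esub> h \<otimes>\<^bsub>G\<^esub> g) \<oplus>\<^bsub>K\<^esub> c h \<otimes>\<^bsub>K\<^esub> b (inv\<^bsub>G\<^esub> h \<otimes>\<^bsub>G\<^esub> g))"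
      unfolding mult_KG_apply[OF abc(3) add_KG_closed[OF abc(1,2)] g]
      by (intro K.finsum_cong') (auto simp: K.r_distr)
    also have "\<dots> = (c \<otimes>\<^bsub>KG\<^esub> a \<oplus>\<^bsub>KG\<^esub> c \<otimes>\<^bsub>KG\<^esub> b) g"
      by simp
    finally show "(c \<otimes>\<^bsub>KG\<^esub> (a \<oplus>\<^bsub>KG\<^esub> b)) g = (c \<otimes>\<^bsub>KG\<^esub> a \<oplus>\<^bsub>KG\<^esub> c \<otimes>\<^bsub>KG\<^esub> b) g" .
  qed (simp_all add: abc add_KG_closed mult_KG_closed)
qed

end

section \<open>The symmetric group algebra\<close>

lemma carrier_sym_group: "carrier (sym_group n) = {p. p permutes {1..n}}"
  by (simp add: sym_group_def)

lemma finite_group_algebra_sym_group: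
  assumes "ring K"
  shows "finite_group_algebra K (sym_group n)"
proof (intro finite_group_algebra.intro finite_group_algebra_axioms.intro)
  show "finite (carrier (sym_group n))"
    by (simp add: carrier_sym_group finite_permutations)
qed (use assms sym_group_is_group in auto)

lemma cycle_of_list_upt_permutes:
  assumes "0 < l" "w \<le> n"
  shows "cycle_of_list [l..<Suc w] permutes {1..n}"
  using cycle_permutes by (rule permutes_subset) (use assms in auto)

lemma transpose_Suc_permutes: "0 < u \<Longrightarrow> u < n \<Longrightarrow> transpose u (Suc u) permutes {1..n}"
  by (rule permutes_swap_id) auto

text \<open>Splitting off the first entry of the cycle is the source of \<open>t_rec\<close> for the
  shuffles.\<close>

lemma cycle_of_list_upt_rec:
  assumes "l < w"
  shows "cycle_of_list [l..<Suc w] = transpose l (Suc l) \<circ> cycle_of_list [Suc l..<Suc w]"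
proof -
  have "[l..<Suc w] = l # Suc l # [Suc (Suc l)..<Suc w]" "[Suc l..<Suc w] = Suc l # [Suc (Suc l)..<Suc w]"
    using assms by (simp_all add: upt_conv_Cons del: upt_Suc)
  then show ?thesis by (simp only: cycle_of_list.simps)
qed

lemma transpose_braid:
  "transpose u (Suc u) \<circ> transpose (Suc u) (Suc (Suc u)) \<circ> transpose u (Suc u)
   = transpose (Suc u) (Suc (Suc u)) \<circ> transpose u (Suc u) \<circ> transpose (Suc u) (Suc (Suc u))"
  by (auto simp: fun_eq_iff transpose_def)

lemma transpose_Suc_comm:
  "Suc u < v \<Longrightarrow> transpose u (Suc u) \<circ> transpose v (Suc v) = transpose v (Suc v) \<circ> transpose u (Suc u)"
  by (auto simp: fun_eq_iff transpose_def)

section \<open>The shuffles in the group algebra and their recursion\<close>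

lemma somewhere_to_below_closed:
  assumes "ring K"
  shows "somewhere_to_below K n l \<in> carrier (sym_group_algebra K n)"
proof -
  interpret A: finite_group_algebra K "sym_group n"
    using assms by (rule finite_group_algebra_sym_group)
  interpret KS: ring "sym_group_algebra K n" by (rule A.ring_KG)
  show ?thesis
    unfolding somewhere_to_below_def by (rule KS.finsum_closed) (simp add: A.ga_of_closed)
qed

lemma somewhere_to_below_top:
  assumes "ring K"
  shows "somewhere_to_below K n n = \<one>\<^bsub>sym_group_algebra K n\<^esub>"
proof -
  interpret A: finite_group_algebra K "sym_group n"
    using assms by (rule finite_group_algebra_sym_group)
  interpret KS: ring "sym_group_algebra K n" by (rule A.ring_KG)
  show ?thesis
    by (simp add: somewhere_to_below_def A.one_KG A.ga_of_closed sym_group_one)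
qed

text \<open>The summand \<open>w = l\<close> is the identity; from every other one the transposition
  splits off on the left.\<close>

lemma somewhere_to_below_rec:
  assumes "ring K" "0 < l" "l < n"
  shows "somewhere_to_below K n l = \<one>\<^bsub>sym_group_algebra K n\<^esub> \<oplus>\<^bsub>sym_group_algebra K n\<^esub>
    ga_of K (sym_group n) (transpose l (Suc l)) \<otimes>\<^bsub>sym_group_algebra K n\<^esub> somewhere_to_below K n (Suc l)"
proof -
  interpret A: finite_group_algebra K "sym_group n"
    using assms(1) by (rule finite_group_algebra_sym_group)
  interpret KS: ring "sym_group_algebra K n" by (rule A.ring_KG)
  let ?A = "sym_group_algebra K n" and ?c = "\<lambda>l w. ga_of K (sym_group n) (cycle_of_list [l..<Suc w])"
  let ?s = "ga_of K (sym_group n) (transpose l (Suc l))"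
  have "{l..n} = insert l {Suc l..n}" using assms by auto
  then have "somewhere_to_below K n l = ?c l l \<oplus>\<^bsub>?A\<^esub> (\<Oplus>\<^bsub>?A\<^esub>w\<in>{Suc l..n}. ?c l w)"
    by (simp add: somewhere_to_below_def A.ga_of_closed KS.finsum_insert del: upt_Suc)
  also have "?c l l = \<one>\<^bsub>?A\<^esub>"
    by (simp add: A.one_KG sym_group_one)
  also have "(\<Oplus>\<^bsub>?A\<^esub>w\<in>{Suc l..n}. ?c l w) = (\<Oplus>\<^bsub>?A\<^esub>w\<in>{Suc l..n}. ?s \<otimes>\<^bsub>?A\<^esub> ?c (Suc l) w)"
  proof (intro KS.finsum_cong' refl)
    fix w assume "w \<in> {Suc l..n}"
    then show "?c l w = ?s \<otimes>\<^bsub>?A\<^esub> ?c (Suc l) w"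
      using assms(2,3)
      by (simp add: A.ga_of_mult carrier_sym_group transpose_Suc_permutes cycle_of_list_upt_permutes
          sym_group_mult cycle_of_list_upt_rec del: upt_Suc One_nat_def)
  qed (auto simp: A.ga_of_closed)
  also have "\<dots> = ?s \<otimes>\<^bsub>?A\<^esub> somewhere_to_below K n (Suc l)"
    unfolding somewhere_to_below_def
    by (intro KS.finsum_rdistr[symmetric]) (auto simp: A.ga_of_closed)
  finally show ?thesis .
qed

text \<open>Out of range, index \<open>0\<close> included, generators are zero and shuffles are one.
  A commutation or braid relation meeting such a generator has both sides zero, and
  \<open>t_rec\<close> reads \<open>\<one> = \<one> \<oplus> \<zero>\<close>.\<close>

lemma shuffle_ring_sym_group_algebra:
  fixes K :: "('k, 'r) ring_scheme" and n :: nat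
  assumes "ring K"
  defines "A \<equiv> sym_group_algebra K n"
  shows "shuffle_ring A n
    (\<lambda>u. if 0 < u \<and> u < n then ga_of K (sym_group n) (transpose u (Suc u)) else \<zero>\<^bsub>A\<^esub>)
    (\<lambda>l. if 0 < l \<and> l \<le> n then somewhere_to_below K n l else \<one>\<^bsub>A\<^esub>)"
proof -
  interpret A: finite_group_algebra K "sym_group n"
    using assms(1) by (rule finite_group_algebra_sym_group)
  interpret KS: ring A unfolding A_def by (rule A.ring_KG)
  define S where "S = (\<lambda>u. if 0 < u \<and> u < n then ga_of K (sym_group n) (transpose u (Suc u)) else \<zero>\<^bsub>A\<^esub>)"
  define T where "T = (\<lambda>l. if 0 < l \<and> l \<le> n then somewhere_to_below K n l else \<one>\<^bsub>A\<^esub>)"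
  have S_eq: "S u = ga_of K (sym_group n) (transpose u (Suc u))" if "0 < u" "u < n" for u
    using that by (simp add: S_def)
  have S_zero: "S u = \<zero>\<^bsub>A\<^esub>" if "\<not> (0 < u \<and> u < n)" for u
    using that by (simp only: S_def if_False)
  have S_closed: "S u \<in> carrier A" for u
    unfolding A_def S_def by (simp add: A.ga_of_closed A.zero_KG_closed)
  have T_closed: "T l \<in> carrier A" for l
    using somewhere_to_below_closed[OF assms(1)] by (simp add: T_def A_def A.one_KG A.ga_of_closed)
  have mult: "ga_of K (sym_group n) p \<otimes>\<^bsub>A\<^esub> ga_of K (sym_group n) q = ga_of K (sym_group n) (p \<circ> q)"
    if "p permutes {1..n}" "q permutes {1..n}" for p q
    using that unfolding A_def by (simp add: A.ga_of_mult carrier_sym_group sym_group_mult)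
  have "shuffle_ring A n S T"
  proof unfold_locales
    show "S u \<in> carrier A" for u by (rule S_closed)
    show "T l \<in> carrier A" for l by (rule T_closed)
    show "S u \<otimes>\<^bsub>A\<^esub> S v = S v \<otimes>\<^bsub>A\<^esub> S u" if "Suc u < v" for u v
    proof (cases "0 < u \<and> v < n")
      case True
      with that have uv: "0 < u" "u < n" "0 < v" "v < n" by auto
      then show ?thesis
        by (simp only: S_eq mult transpose_Suc_permutes transpose_Suc_comm[OF that])
    next
      case False
      then have "S u = \<zero>\<^bsub>A\<^esub> \<or> S v = \<zero>\<^bsub>A\<^esub>" using S_zero by blast
      then show ?thesis using S_closed by auto
    qed
    show "S u \<otimes>\<^bsub>A\<^esub> S (Suc u) \<otimes>\<^bsub>A\<^esub> S u = S (Suc u) \<otimes>\<^bsub>A\<^esub> S u \<otimes>\<^bsub>A\<^esub> S (Suc u)" for u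
    proof (cases "0 < u \<and> Suc u < n")
      case True
      then have u: "0 < u" "u < n" "0 < Suc u" "Suc u < n" by auto
      then show ?thesis
        by (simp only: S_eq mult transpose_Suc_permutes permutes_compose transpose_braid)
    next
      case False
      then have "S u = \<zero>\<^bsub>A\<^esub> \<or> S (Suc u) = \<zero>\<^bsub>A\<^esub>" using S_zero by blast
      then show ?thesis using S_closed by auto
    qed
    show "S u \<otimes>\<^bsub>A\<^esub> S u = \<one>\<^bsub>A\<^esub>" if "0 < u" "u < n" for u
    proof -
      have "S u \<otimes>\<^bsub>A\<^esub> S u = ga_of K (sym_group n) (transpose u (Suc u) \<circ> transpose u (Suc u))"
        using that by (simp only: S_eq mult transpose_Suc_permutes)
      then show ?thesis by (simp add: A_def A.one_KG sym_group_one)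
    qed
    show "S u = \<zero>\<^bsub>A\<^esub>" if "n \<le> u" for u
      using that by (simp add: S_zero)
    show "T l = \<one>\<^bsub>A\<^esub> \<oplus>\<^bsub>A\<^esub> S l \<otimes>\<^bsub>A\<^esub> T (Suc l)" for l
    proof (cases "0 < l \<and> l < n")
      case True
      then show ?thesis
        using somewhere_to_below_rec[OF assms(1)] by (simp add: A_def S_def T_def)
    next
      \<comment> \<open>At \<open>l = n > 0\<close> the shuffle is the single summand
        \<open>\<one>\<close>, in agreement with the default value.\<close>
      case False
      then have "T l = \<one>\<^bsub>A\<^esub>"
        using somewhere_to_below_top[OF assms(1), of n] by (auto simp: A_def T_def le_less)
      with S_zero[OF False] show ?thesis using T_closed by simp
    qed
  qed
  then show ?thesis by (simp only: S_def T_def)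
qed

theorem theorem8p15:
  fixes K :: "('k, 'r) ring_scheme"
    and n j m :: nat
    and i :: "nat \<Rightarrow> nat"
  assumes "cring K"
    and "j \<in> {1..n}"
    and "2 * m \<ge> n - j + 2"
    and "\<forall>k\<in>{1..m}. i k \<in> {1..j}"
  shows "list_product (sym_group_algebra K n)
           (map (\<lambda>k. commutator (sym_group_algebra K n)
                       (somewhere_to_below K n (i k)) (somewhere_to_below K n j))
                [1..<Suc m])
         = \<zero>\<^bsub>sym_group_algebra K n\<^esub>"
proof -
  let ?A = "sym_group_algebra K n"
  have "ring K" using assms(1) by (rule cring.axioms)
  then interpret shuffle_ring ?A n
    "\<lambda>u. if 0 < u \<and> u < n then ga_of K (sym_group n) (transpose u (Suc u)) else \<zero>\<^bsub>?A\<^esub>"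
    "\<lambda>l. if 0 < l \<and> l \<le> n then somewhere_to_below K n l else \<one>\<^bsub>?A\<^esub>"
    by (rule shuffle_ring_sym_group_algebra)
  \<comment> \<open>With \<open>j \<le> n\<close>, these bounds keep every index in range, so the
    default values do not enter the product.\<close>
  have i: "0 < i k \<and> i k \<le> j" if "k \<in> {1..m}" for k
    using assms(4) that by force
  \<comment> \<open>As \<open>j \<le> n\<close>, the truncated difference \<open>n - j\<close> is
    exact and the bound on \<open>m\<close> becomes \<open>n + 2 \<le> j + 2 * m\<close>.\<close>
  have "list_product ?A (map (\<lambda>l. commutator ?A
      (if 0 < l \<and> l \<le> n then somewhere_to_below K n l else \<one>\<^bsub>?A\<^esub>)
      (if 0 < j \<and> j \<le> n then somewhere_to_below K n j else \<one>\<^bsub>?A\<^esub>)) (map i [1..<Suc m])) = \<zero>\<^bsub>?A\<^esub>"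
    using assms(2,3) i by (intro commutator_product_eq_zero) auto
  moreover have "map (\<lambda>l. commutator ?A
      (if 0 < l \<and> l \<le> n then somewhere_to_below K n l else \<one>\<^bsub>?A\<^esub>)
      (if 0 < j \<and> j \<le> n then somewhere_to_below K n j else \<one>\<^bsub>?A\<^esub>)) (map i [1..<Suc m])
    = map (\<lambda>k. commutator ?A (somewhere_to_below K n (i k)) (somewhere_to_below K n j)) [1..<Suc m]"
    unfolding map_map using assms(2) i by (intro map_cong refl) force
  ultimately show ?thesis by (simp only:)
qed

end
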